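(* For every integer $n\ge1$, the Hilbert basis of the lecture hall cone $L_n$ (i.e., the unique minimal generating set of the semigroup $L_n\cap\mathbb{Z}^n$) is \[ \mathcal{H}_n=\{v_A : A\subseteq\{1,2,\ldots,n-1\}\}. \]
   Context: $L_n:=\{\lambda\in\mathbb{R}^n : 0\le \frac{\lambda_1}{1}\le\frac{\lambda_2}{2}\le\cdots\le\frac{\lambda_n}{n}\}$. For $A=\{i_1<i_2<\cdots<i_k\}\subseteq\{1,\ldots,n-1\}$, $v_A\in\mathbb{Z}^n$ is the vector $v_A=(0,\ldots,0,i_1,i_2,\ldots,i_k,i_k+1)$ (the last $k+1$ coordinates are $i_1,\ldots,i_k,i_k+1$ and the first $n-k-1$ coordinates are $0$); for $A=\emptyset$ this means $v_\emptyset=(0,\ldots,0,1)$. *)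

theory Defs
  imports "Jordan_Normal_Form.Matrix"
begin

(* Vectors of R^n are elements of carrier_vec n; the i-th coordinate (1 <= i <= n) of x is x $ (i - 1). *)

definition integer_points :: "nat \<Rightarrow> real vec set" where
  "integer_points n = {x \<in> carrier_vec n. \<forall>i<n. x $ i \<in> \<int>}"

definition lecture_hall_cone :: "nat \<Rightarrow> real vec set" where
  "lecture_hall_cone n =
     {x \<in> carrier_vec n. 0 \<le> x $ 0 / 1 \<and>
        (\<forall>i\<in>{1..<n}. x $ (i - 1) / real i \<le> x $ i / real (i + 1))}"

(* All finite sums, with repetition, of elements of S; the empty sum 0 is included,
   as is customary for Hilbert bases. *)
inductive_set generated_semigroup :: "nat \<Rightarrow> real vec set \<Rightarrow> real vec set"
  for n :: nat and S :: "real vec set" where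
  zero: "0\<^sub>v n \<in> generated_semigroup n S"
| add: "x \<in> S \<Longrightarrow> y \<in> generated_semigroup n S \<Longrightarrow> x + y \<in> generated_semigroup n S"

definition generates :: "nat \<Rightarrow> real vec set \<Rightarrow> real vec set \<Rightarrow> bool" where
  "generates n S M \<longleftrightarrow> S \<subseteq> M \<and> generated_semigroup n S = M"

definition minimal_generating_set :: "nat \<Rightarrow> real vec set \<Rightarrow> real vec set \<Rightarrow> bool" where
  "minimal_generating_set n S M \<longleftrightarrow> generates n S M \<and> (\<forall>T. T \<subset> S \<longrightarrow> \<not> generates n T M)"

(* H is the unique minimal generating set of the semigroup of integer points of C. *)
definition is_hilbert_basis :: "nat \<Rightarrow> real vec set \<Rightarrow> real vec set \<Rightarrow> bool" where
  "is_hilbert_basis n C H \<longleftrightarrow>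
     minimal_generating_set n H (C \<inter> integer_points n) \<and>
     (\<forall>H'. minimal_generating_set n H' (C \<inter> integer_points n) \<longrightarrow> H' = H)"

definition v_vec :: "nat \<Rightarrow> nat set \<Rightarrow> real vec" where
  "v_vec n A = vec_of_list (map real
     (replicate (n - card A - 1) 0 @ sorted_list_of_set A @ [if A = {} then 1 else Max A + 1]))"

end

(* On nonzero integer points of the cone the height x_n - x_(n-1) is an integer, at least 1, and it
   is additive and equal to 1 on every v_A; hence every v_A belongs to every generating set.
   Conversely, an integer point of positive height is peeled by truncating all ratios x_i / i with
   i < n at 1: the vector with entries min(i, x_i) for i < n, whose last entry exceeds the
   preceding one by 1, has strictly increasing nonzero entries and is therefore some v_A.
   The difference again lies in the cone, because the ratios max(0, x_i / i - 1) are still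
   monotone, and its height has dropped by 1. *)

theory Submission imports Defs begin

section \<open>Lists of zeros followed by strictly increasing positive entries\<close>

abbreviation "eventually_increasing \<equiv> sorted_wrt (\<lambda>a b::nat. a = 0 \<or> a < b)"

text \<open>If a is nonzero then a < b makes b nonzero, so b < c. Transitivity reduces the pairwise
  condition to adjacent entries, the form in which the cone inequalities deliver it.\<close>

lemma transp_zero_or_less: "transp (\<lambda>a b::nat. a = 0 \<or> a < b)"
  by (auto intro!: transpI)

lemma eventually_increasing_iff:
  "eventually_increasing ws \<longleftrightarrow> (\<forall>i. Suc i < length ws \<longrightarrow> ws ! i = 0 \<or> ws ! i < ws ! Suc i)"
  by (rule sorted_wrt_iff_nth_Suc_transp[OF transp_zero_or_less])

lemma eventually_increasing_padded:
  assumes "finite A"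
  shows "eventually_increasing (replicate k 0 @ sorted_list_of_set A)"
proof -
  have "sorted_wrt (<) (sorted_list_of_set A)"
    by simp
  then have "eventually_increasing (sorted_list_of_set A)"
    by (rule sorted_wrt_mono_rel[rotated]) auto
  moreover have "eventually_increasing (replicate k 0)"
    by (induction k) auto
  ultimately show ?thesis
    by (auto simp: sorted_wrt_append)
qed

text \<open>Zero heads are stripped one at a time; from a nonzero head on, the list is strictly
  increasing and so is the sorted list of its own set. Hence length and nonzero entries determine
  the list, which recovers A from v_A.\<close>

lemma eventually_increasing_eq_padded:
  assumes "eventually_increasing ws"
  shows "ws = replicate (length ws - card (set ws - {0})) 0 @ sorted_list_of_set (set ws - {0})"
  using assms
proof (induction ws)
  case (Cons w ws)
  show ?case
  proof (cases "w = 0")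
    case True
    have "card (set ws - {0}) \<le> length ws"
      by (meson Diff_subset List.finite_set card_length card_mono order_trans)
    then show ?thesis
      using Cons True by (auto simp: Suc_diff_le)
  next
    case False
    have "0 \<notin> set (w # ws)"
      using Cons.prems False by auto
    moreover from this have "sorted_wrt (<) (w # ws)"
      using Cons.prems by (auto elim!: sorted_wrt_mono_rel[rotated])
    ultimately show ?thesis
      by (metis Diff_empty Diff_insert0 append_Nil cancel_comm_monoid_add_class.diff_cancel
          distinct_card replicate_0 sorted_list_of_set.idem_if_sorted_distinct
          strict_sorted_iff)
  qed
qed simp

section \<open>The vectors v_A described by their first n - 1 coordinates\<close>

definition hall_vec :: "nat list \<Rightarrow> real vec" where
  "hall_vec ws = vec_of_list (map real (ws @ [last (0 # ws) + 1]))"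

lemma hall_vec_carrier: "hall_vec ws \<in> carrier_vec (Suc (length ws))"
  by (rule carrier_vecI) (simp add: hall_vec_def)

lemma hall_vec_nth: "i < length ws \<Longrightarrow> hall_vec ws $ i = real (ws ! i)"
  by (simp add: hall_vec_def vec_of_list_index nth_append del: map_append)

lemma hall_vec_last: "hall_vec ws $ length ws = real (last (0 # ws)) + 1"
  by (simp add: hall_vec_def vec_of_list_index nth_append del: map_append)

lemma v_vec_eq_hall_vec:
  assumes "finite A"
  shows "v_vec (Suc m) A = hall_vec (replicate (m - card A) 0 @ sorted_list_of_set A)"
proof (cases "A = {}")
  case False
  define xs where "xs = sorted_list_of_set A"
  have xs: "xs \<noteq> []" "set xs = A" "sorted (butlast xs @ [last xs])"
    using False assms by (simp_all add: xs_def)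
  have "Max A = last xs"
  proof (rule Max_eqI)
    show "last xs \<in> A"
      using xs by auto
    fix y assume "y \<in> A"
    then have "y \<in> set (butlast xs @ [last xs])"
      using xs(1,2) by simp
    then show "y \<le> last xs"
      using xs(3) by (auto simp: sorted_append)
  qed (rule assms)
  then show ?thesis
    using False assms by (simp add: v_vec_def hall_vec_def xs_def)
next
  case True
  \<comment> \<open>The 0 prepended in \<open>hall_vec\<close> covers m = 0 as well, where the list
    is empty; the last coordinate then is 1, as it must be for the empty A.\<close>
  have "last (0 # replicate m (0::nat)) = 0"
    by (cases m) auto
  with True show ?thesis
    by (simp add: v_vec_def hall_vec_def)
qed

text \<open>Trades subsets for coordinate lists, on which the cone inequalities can be checked
  entrywise. The inverse map takes the set of nonzero entries.\<close>

lemma v_vec_image_eq: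
  "{v_vec (Suc m) A | A. A \<subseteq> {1..m}}
    = {hall_vec ws | ws. length ws = m \<and> set ws \<subseteq> {0..m} \<and> eventually_increasing ws}"
    (is "?L = ?R")
proof
  show "?L \<subseteq> ?R"
  proof clarify
    fix A assume A: "A \<subseteq> {1..m}"
    then have fin: "finite A"
      by (rule finite_subset) simp
    have "card A \<le> m"
      using card_mono[OF _ A] by simp
    let ?ws = "replicate (m - card A) 0 @ sorted_list_of_set A"
    have "length ?ws = m" "set ?ws \<subseteq> {0..m}" "eventually_increasing ?ws"
      using A fin \<open>card A \<le> m\<close> eventually_increasing_padded[OF fin] by auto
    then show "\<exists>ws. v_vec (Suc m) A = hall_vec ws \<and>
        length ws = m \<and> set ws \<subseteq> {0..m} \<and> eventually_increasing ws"
      using v_vec_eq_hall_vec[OF fin] by blast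
  qed
  show "?R \<subseteq> ?L"
  proof clarify
    fix ws assume ws: "set ws \<subseteq> {0..length ws}" "eventually_increasing ws"
    let ?A = "set ws - {0}"
    have "?A \<subseteq> {1..length ws}"
      using ws(1) by fastforce
    moreover have "hall_vec ws = v_vec (Suc (length ws)) ?A"
      using v_vec_eq_hall_vec[of ?A "length ws"] eventually_increasing_eq_padded[OF ws(2)] by simp
    ultimately show "\<exists>A. hall_vec ws = v_vec (Suc (length ws)) A \<and> A \<subseteq> {1..length ws}"
      by blast
  qed
qed

section \<open>Inequalities of the cone\<close>

lemma mem_lecture_hall_cone:
  "x \<in> lecture_hall_cone n \<longleftrightarrow> x \<in> carrier_vec n \<and> 0 \<le> x $ 0 \<and>
     (\<forall>i. Suc i < n \<longrightarrow> (real i + 2) * x $ i \<le> (real i + 1) * x $ Suc i)"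
proof -
  have "(\<forall>i\<in>{1..<n}. x $ (i - 1) / real i \<le> x $ i / real (i + 1)) \<longleftrightarrow>
    (\<forall>i. Suc i < n \<longrightarrow> x $ i / real (Suc i) \<le> x $ Suc i / real (Suc i + 1))"
    by (auto simp: Ball_def gr0_conv_Suc Suc_le_eq)
  also have "\<dots> \<longleftrightarrow> (\<forall>i. Suc i < n \<longrightarrow> (real i + 2) * x $ i \<le> (real i + 1) * x $ Suc i)"
    by (simp add: divide_simps algebra_simps)
  finally show ?thesis
    by (simp add: lecture_hall_cone_def)
qed

lemma lecture_hall_cone_nonneg:
  assumes "x \<in> lecture_hall_cone n" "i < n"
  shows "0 \<le> x $ i"
  using assms(2)
proof (induction i)
  case 0
  then show ?case using assms(1) by (simp add: mem_lecture_hall_cone)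
next
  case (Suc i)
  then have "0 \<le> (real i + 2) * x $ i" by simp
  also have "\<dots> \<le> (real i + 1) * x $ Suc i"
    using assms(1) Suc.prems by (simp add: mem_lecture_hall_cone)
  finally show ?case by (simp add: zero_le_mult_iff)
qed

text \<open>The last ratio is the largest and all are nonnegative, so its vanishing forces the
  others to vanish, by induction downwards from m.\<close>

lemma lecture_hall_cone_eq_zero:
  assumes x: "x \<in> lecture_hall_cone (Suc m)" and "x $ m = 0"
  shows "x = 0\<^sub>v (Suc m)"
proof -
  have "x $ i = 0" if "i \<le> m" for i
    using that
  proof (induction rule: inc_induct)
    case (step i)
    then have "(real i + 2) * x $ i \<le> 0"
      using x by (auto simp: mem_lecture_hall_cone dest: spec[of _ i])
    then have "x $ i \<le> 0"
      by (simp add: mult_le_0_iff)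
    then show ?case
      using lecture_hall_cone_nonneg[OF x, of i] step.hyps by simp
  qed (use assms in simp)
  then show ?thesis
    using x by (auto simp: mem_lecture_hall_cone)
qed

section \<open>The semigroup of integer points and its height\<close>

abbreviation "lecture_hall_points n \<equiv> lecture_hall_cone n \<inter> integer_points n"

lemma zero_mem_lecture_hall_points: "n \<ge> 1 \<Longrightarrow> 0\<^sub>v n \<in> lecture_hall_points n"
  by (auto simp: mem_lecture_hall_cone integer_points_def)

lemma add_mem_lecture_hall_points:
  assumes "n \<ge> 1" "x \<in> lecture_hall_points n" "y \<in> lecture_hall_points n"
  shows "x + y \<in> lecture_hall_points n"
  using assms by (auto simp: mem_lecture_hall_cone integer_points_def distrib_left intro!: add_mono)

text \<open>With n = m + 1 this is x_n - x_(n-1), where x_0 is read as 0 when n = 1.\<close>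

definition height :: "nat \<Rightarrow> real vec \<Rightarrow> real" where
  "height m x = x $ m - (if m = 0 then 0 else x $ (m - 1))"

lemma height_add:
  "x \<in> carrier_vec (Suc m) \<Longrightarrow> y \<in> carrier_vec (Suc m) \<Longrightarrow> height m (x + y) = height m x + height m y"
  by (auto simp: height_def)

text \<open>A nonzero point has positive last coordinate. The last ratio inequality then makes the
  preceding coordinate strictly smaller, and integrality turns a positive height into one of at
  least 1.\<close>

lemma height_ge_1:
  assumes x: "x \<in> lecture_hall_points (Suc m)" and "x \<noteq> 0\<^sub>v (Suc m)"
  shows "height m x \<ge> 1"
proof -
  have "x $ m \<noteq> 0" "x $ m \<ge> 0"
    using assms lecture_hall_cone_eq_zero lecture_hall_cone_nonneg[of x "Suc m" m] by auto
  have "height m x > 0"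
  proof (cases m)
    case 0
    then show ?thesis using \<open>x $ m \<noteq> 0\<close> \<open>x $ m \<ge> 0\<close> by (simp add: height_def)
  next
    case (Suc k)
    have "(real k + 2) * x $ k \<le> (real k + 1) * x $ m"
      using x Suc by (simp add: mem_lecture_hall_cone)
    also have "\<dots> < (real k + 2) * x $ m"
      using \<open>x $ m \<noteq> 0\<close> \<open>x $ m \<ge> 0\<close> by simp
    finally show ?thesis using Suc by (simp add: height_def)
  qed
  moreover have "height m x \<in> \<int>"
    using x by (auto simp: height_def integer_points_def intro!: Ints_diff)
  ultimately show ?thesis
    by (auto elim!: Ints_cases)
qed

lemma height_hall_vec: "height (length ws) (hall_vec ws) = 1"
  using hall_vec_last[of ws] by (cases "ws = []") (auto simp: height_def hall_vec_nth last_conv_nth)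

section \<open>Every v_A lies in the cone\<close>

lemma eventually_increasing_nth_le:
  assumes "eventually_increasing ws" "set ws \<subseteq> {0..length ws}" "i < length ws"
  shows "ws ! i \<le> Suc i"
proof -
  \<comment> \<open>Downward induction: the last entry is at most the length, and each step to the
    left either meets 0 or loses at least 1.\<close>
  have "i \<le> length ws - 1"
    using assms(3) by simp
  then show ?thesis
  proof (induction rule: inc_induct)
    case base
    have "ws ! (length ws - 1) \<in> set ws"
      using assms(3) by (intro nth_mem) simp
    then show ?case
      using assms(2,3) by (force simp del: nth_mem)
  next
    case (step i)
    then have "ws ! i = 0 \<or> ws ! i < ws ! Suc i"
      using assms(1) by (auto simp: eventually_increasing_iff)
    with step.IH show ?case by linarith
  qed
qed

text \<open>A zero entry makes its inequality trivial. A nonzero entry w at index i has w \<le> i +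
  1 and a successor of at least w + 1, so (i + 2) w \<le> (i + 1) (w + 1) suffices.\<close>

lemma hall_vec_mem_points:
  assumes ws: "eventually_increasing ws" "set ws \<subseteq> {0..length ws}"
  shows "hall_vec ws \<in> lecture_hall_points (Suc (length ws))"
proof -
  have step: "(real i + 2) * hall_vec ws $ i \<le> (real i + 1) * hall_vec ws $ Suc i"
    if i: "i < length ws" for i
  proof -
    have le: "real (ws ! i) \<le> real i + 1"
      using eventually_increasing_nth_le[OF ws i] by simp
    have "ws ! i = 0 \<or> real (ws ! i) + 1 \<le> hall_vec ws $ Suc i"
    proof (cases "Suc i < length ws")
      case True
      then show ?thesis
        using ws(1) by (fastforce simp: eventually_increasing_iff hall_vec_nth)
    next
      case False
      with i have "Suc i = length ws" by simp
      moreover from this have "last (0 # ws) = ws ! i"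
        by (metis diff_Suc_1 i last_ConsR last_conv_nth length_0_conv not_less_zero)
      ultimately show ?thesis
        using hall_vec_last[of ws] by simp
    qed
    then show ?thesis
    proof
      assume "ws ! i = 0"
      moreover have "hall_vec ws $ Suc i \<ge> 0"
        using hall_vec_nth[of "Suc i" ws] hall_vec_last[of ws] i
        by (cases "Suc i = length ws") auto
      ultimately show ?thesis
        using i by (simp add: hall_vec_nth)
    next
      assume "real (ws ! i) + 1 \<le> hall_vec ws $ Suc i"
      then have "(real i + 1) * (real (ws ! i) + 1) \<le> (real i + 1) * hall_vec ws $ Suc i"
        by (intro mult_left_mono) auto
      then show ?thesis
        using le i by (simp add: hall_vec_nth algebra_simps)
    qed
  qed
  have nat: "hall_vec ws $ i \<in> \<nat>" if "i \<le> length ws" for i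
    using that hall_vec_nth[of i ws] hall_vec_last[of ws] by (cases "i = length ws") auto
  have "hall_vec ws $ 0 \<ge> 0"
    using nat[of 0] by (auto elim!: Nats_cases)
  then show ?thesis
    using step nat Nats_subset_Ints hall_vec_carrier[of ws]
    by (fastforce simp: mem_lecture_hall_cone integer_points_def)
qed

section \<open>Peeling one v_A off an integer point of positive height\<close>

lemma peel_hall_vec:
  assumes x: "x \<in> lecture_hall_points (Suc m)" and h: "height m x \<ge> 1"
  obtains ws where "length ws = m" "set ws \<subseteq> {0..m}" "eventually_increasing ws"
    "x - hall_vec ws \<in> lecture_hall_points (Suc m)"
proof -
  define a where "a i = nat \<lfloor>x $ i\<rfloor>" for i
  have a: "x $ i = real (a i)" if "i \<le> m" for i
    using x that lecture_hall_cone_nonneg[of x "Suc m" i]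
    by (auto simp: a_def integer_points_def less_Suc_eq_le floor_of_int elim!: Ints_cases
        dest!: spec[of _ i])
  have cone: "(i + 2) * a i \<le> (i + 1) * a (Suc i)" if "i < m" for i
  proof -
    have "(real i + 2) * x $ i \<le> (real i + 1) * x $ Suc i"
      using x that by (simp add: mem_lecture_hall_cone)
    then have "real ((i + 2) * a i) \<le> real ((i + 1) * a (Suc i))"
      using a[of i] a[of "Suc i"] that by (simp add: algebra_simps)
    then show ?thesis by linarith
  qed
  define ws where "ws = map (\<lambda>i. min (Suc i) (a i)) [0..<m]"
  have len: "length ws = m" and nth: "\<And>i. i < m \<Longrightarrow> ws ! i = min (Suc i) (a i)"
    by (simp_all add: ws_def)
  have inc: "eventually_increasing ws"
    unfolding eventually_increasing_iff
  proof (intro allI impI)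
    fix i assume i: "Suc i < length ws"
    \<comment> \<open>If a (i + 1) \<le> a i, the cone inequality gives (i + 2) a i \<le> (i + 1) a
      i, hence a i = 0. Truncation at i + 1 and i + 2 preserves the strict increase.\<close>
    have "a i = 0 \<or> a i < a (Suc i)"
    proof (rule ccontr)
      assume contra: "\<not> ?thesis"
      then have "(i + 1) * a (Suc i) \<le> (i + 1) * a i"
        by (intro mult_left_mono) auto
      with cone[of i] i len contra show False by simp
    qed
    with i len show "ws ! i = 0 \<or> ws ! i < ws ! Suc i"
      by (auto simp: nth)
  qed
  have set: "set ws \<subseteq> {0..m}"
    by (auto simp: ws_def)
  have w: "hall_vec ws $ i = real (min (Suc i) (a i))" if "i < m" for i
    using that hall_vec_nth[of i ws] by (simp add: len nth)
  have d: "(x - hall_vec ws) $ i = x $ i - hall_vec ws $ i" if "i \<le> m" for i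
    using that hall_vec_carrier[of ws] len by auto
  have step: "(real i + 2) * (x - hall_vec ws) $ i \<le> (real i + 1) * (x - hall_vec ws) $ Suc i"
    if i: "i < m" for i
  proof -
    define D where "D = (x - hall_vec ws) $ Suc i"
    have xi: "(x - hall_vec ws) $ i = max 0 (real (a i) - (real i + 1))"
      using i by (simp add: d a w max_def min_def)
    \<comment> \<open>Two lower bounds on the next coordinate suffice, and they also fit the last
      one, which is not truncated but set to its predecessor plus 1.\<close>
    have "D \<ge> 0 \<and> (a i \<ge> Suc i \<longrightarrow> D \<ge> real (a (Suc i)) - (real i + 2))"
    proof (cases "Suc i < m")
      case True
      then show ?thesis
        unfolding D_def by (auto simp: d a w max_def min_def)
    next
      case False
      with i have m: "m = Suc i" by simp
      have "last (0 # ws) = ws ! i"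
        using len m by (auto simp: last_conv_nth)
      then have last: "hall_vec ws $ Suc i = real (min (Suc i) (a i)) + 1"
        using hall_vec_last[of ws] len m nth[of i] by simp
      \<comment> \<open>Positive height enters here: it keeps the last coordinate of the difference
        nonnegative.\<close>
      have "real (a (Suc i)) - real (a i) \<ge> 1"
        using h a[of i] a[of "Suc i"] m by (simp add: height_def)
      then show ?thesis
        unfolding D_def using m by (auto simp: d a last min_def)
    qed
    then have D: "D \<ge> 0" "a i \<ge> Suc i \<Longrightarrow> D \<ge> real (a (Suc i)) - (real i + 2)"
      by auto
    show ?thesis
    proof (cases "a i \<ge> Suc i")
      case True
      have "real ((i + 2) * a i) \<le> real ((i + 1) * a (Suc i))"
        using cone[OF i] by (rule of_nat_mono)
      \<comment> \<open>Subtracting 1 from both ratios amounts to subtracting (i + 1) (i + 2) from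
        both sides.\<close>
      then have "(real i + 2) * (real (a i) - (real i + 1))
          \<le> (real i + 1) * (real (a (Suc i)) - (real i + 2))"
        by (simp add: algebra_simps)
      also have "\<dots> \<le> (real i + 1) * D"
        using D(2)[OF True] by (intro mult_left_mono) auto
      finally show ?thesis
        using True by (simp add: xi D_def)
    next
      case False
      then show ?thesis using D(1) by (simp add: xi D_def)
    qed
  qed
  have "(x - hall_vec ws) $ 0 \<ge> 0"
  proof (cases m)
    case 0
    then show ?thesis
      using h hall_vec_last[of ws] len d[of 0] by (simp add: height_def)
  next
    case (Suc k)
    then show ?thesis by (simp add: d a w)
  qed
  moreover have "(x - hall_vec ws) $ i \<in> \<int>" if "i \<le> m" for i
    using that x hall_vec_mem_points[OF inc] len set
    by (auto simp: d integer_points_def less_Suc_eq_le intro!: Ints_diff)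
  moreover have "x - hall_vec ws \<in> carrier_vec (Suc m)"
    using x hall_vec_carrier[of ws] len by (simp add: mem_lecture_hall_cone)
  ultimately have "x - hall_vec ws \<in> lecture_hall_points (Suc m)"
    using step by (auto simp: mem_lecture_hall_cone integer_points_def less_Suc_eq_le)
  with len set inc show thesis by (rule that)
qed

section \<open>Generation, and necessity of each generator\<close>

lemma generated_semigroup_subset_points:
  assumes "n \<ge> 1" "S \<subseteq> lecture_hall_points n"
  shows "generated_semigroup n S \<subseteq> lecture_hall_points n"
proof
  fix x assume "x \<in> generated_semigroup n S"
  then show "x \<in> lecture_hall_points n"
    by induction (use assms zero_mem_lecture_hall_points add_mem_lecture_hall_points in blast)+
qed

lemma points_subset_generated_semigroup:
  assumes hall: "\<And>ws. length ws = m \<Longrightarrow> set ws \<subseteq> {0..m} \<Longrightarrow> eventually_increasing ws \<Longrightarrow> hall_vec ws \<in> S"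
  shows "lecture_hall_points (Suc m) \<subseteq> generated_semigroup (Suc m) S"
proof
  fix x assume "x \<in> lecture_hall_points (Suc m)"
  \<comment> \<open>The height is a real number, so its floor as a natural number serves as the
    measure; each peeling lowers it by 1.\<close>
  then show "x \<in> generated_semigroup (Suc m) S"
  proof (induction "nat \<lfloor>height m x\<rfloor>" arbitrary: x rule: less_induct)
    case less
    show ?case
    proof (cases "x = 0\<^sub>v (Suc m)")
      case True
      then show ?thesis by (simp add: generated_semigroup.zero)
    next
      case False
      then have h: "height m x \<ge> 1"
        using less.prems by (rule height_ge_1[rotated])
      obtain ws where ws: "length ws = m" "set ws \<subseteq> {0..m}" "eventually_increasing ws"
        and diff: "x - hall_vec ws \<in> lecture_hall_points (Suc m)"
        using peel_hall_vec[OF less.prems h] .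
      have carrier: "x \<in> carrier_vec (Suc m)" "hall_vec ws \<in> carrier_vec (Suc m)"
        using less.prems hall_vec_carrier[of ws] ws(1) by (auto simp: mem_lecture_hall_cone)
      have eq: "hall_vec ws + (x - hall_vec ws) = x"
        using carrier by auto
      have "height m x = 1 + height m (x - hall_vec ws)"
        using height_add[of "hall_vec ws" m "x - hall_vec ws"] carrier height_hall_vec[of ws] ws(1) eq
        by simp
      then have "nat \<lfloor>height m (x - hall_vec ws)\<rfloor> < nat \<lfloor>height m x\<rfloor>"
        using h by linarith
      then have "x - hall_vec ws \<in> generated_semigroup (Suc m) S"
        using less.hyps diff by blast
      then have "hall_vec ws + (x - hall_vec ws) \<in> generated_semigroup (Suc m) S"
        using hall[OF ws] by (rule generated_semigroup.add[rotated])
      then show ?thesis by (simp add: eq)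
    qed
  qed
qed

text \<open>Points of height 1 are irreducible: heights add and nonzero points have height at least
  1, so one of two summands is 0 and the other is the point itself.\<close>

lemma height_1_mem_generators:
  assumes S: "S \<subseteq> lecture_hall_points (Suc m)" and x: "x \<in> generated_semigroup (Suc m) S"
    and h: "height m x = 1"
  shows "x \<in> S"
  using x h
proof induction
  case zero
  then show ?case by (simp add: height_def split: if_splits)
next
  case (add x y)
  have pts: "x \<in> lecture_hall_points (Suc m)" "y \<in> lecture_hall_points (Suc m)"
    using add.hyps S generated_semigroup_subset_points[OF _ S] by auto
  then have carrier: "x \<in> carrier_vec (Suc m)" "y \<in> carrier_vec (Suc m)"
    by (auto simp: mem_lecture_hall_cone)
  then have "height m x + height m y = 1"
    using add.prems by (simp add: height_add)
  then have "x = 0\<^sub>v (Suc m) \<or> y = 0\<^sub>v (Suc m)"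
    using height_ge_1[OF pts(1)] height_ge_1[OF pts(2)] by fastforce
  then show ?case
  proof
    assume "x = 0\<^sub>v (Suc m)"
    then have "x + y = y" using carrier by simp
    then show ?thesis using add by simp
  next
    assume "y = 0\<^sub>v (Suc m)"
    then have "x + y = x" using carrier by simp
    then show ?thesis using add by simp
  qed
qed

theorem theorem6:
  fixes n :: nat
  assumes "n \<ge> 1"
  shows "is_hilbert_basis n (lecture_hall_cone n) {v_vec n A | A. A \<subseteq> {1..n - 1}}"
proof -
  obtain m where n: "n = Suc m"
    using assms by (cases n) auto
  define H where "H = {v_vec n A | A. A \<subseteq> {1..n - 1}}"
  have H: "H = {hall_vec ws | ws. length ws = m \<and> set ws \<subseteq> {0..m} \<and> eventually_increasing ws}"
    unfolding H_def n using v_vec_image_eq[of m] by simp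
  have sub: "H \<subseteq> lecture_hall_points n"
    unfolding H n using hall_vec_mem_points by auto
  have "generated_semigroup n H = lecture_hall_points n"
  proof
    show "generated_semigroup n H \<subseteq> lecture_hall_points n"
      using generated_semigroup_subset_points[OF assms sub] .
    show "lecture_hall_points n \<subseteq> generated_semigroup n H"
      unfolding n by (rule points_subset_generated_semigroup) (auto simp: H)
  qed
  with sub have gen: "generates n H (lecture_hall_points n)"
    by (simp add: generates_def)
  \<comment> \<open>Being contained in every generating set settles both claims: no proper subset of
    H generates, and a minimal generating set cannot properly contain the generating set H.\<close>
  have least: "H \<subseteq> T" if T: "generates n T (lecture_hall_points n)" for T
  proof
    fix x assume x: "x \<in> H"
    then have "height m x = 1"
      using height_hall_vec by (auto simp: H)
    moreover have "T \<subseteq> lecture_hall_points (Suc m)" "x \<in> generated_semigroup (Suc m) T"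
      using T x sub by (auto simp: generates_def n)
    ultimately show "x \<in> T"
      using height_1_mem_generators by blast
  qed
  have "is_hilbert_basis n (lecture_hall_cone n) H"
    unfolding is_hilbert_basis_def minimal_generating_set_def
    using gen least by blast
  then show ?thesis by (simp add: H_def)
qed

end
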